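(* Let $\alpha>0$, $dt>0$, $dx>0$ and let $s\ge1$ be an integer. The $s$-stage RKG1 method applied to the constant coefficient heat equation under periodic or homogeneous Neumann boundary condition is monotone if it satisfies its stability constraint $$\alpha\frac{dt}{dx^2}\le\frac{s^2+3s}{8}.$$
   Context: Setting: the heat equation $u_t=\alpha u_{xx}$ with constant $\alpha>0$ is discretized in space by central differences as $\frac{du}{dt}=\alpha Mu$, where $u\in\mathbb{R}^{\mathbb{Z}}$, $[Mu]_i=\frac{[u]_{i+1}-2[u]_i+[u]_{i-1}}{dx^2}$, $dx>0$ is the grid size and $dt>0$ the (super) timestep. Periodic boundary conditions are treated as the boundaryless problem on $\mathbb{Z}$ with repeated values, and homogeneous Neumann boundary conditions as the periodic problem on the reflected and doubled domain; thus the scheme under either boundary condition is the scheme on $\mathbb{R}^{\mathbb{Z}}$. $C_s^{(\lambda)}$ denotes the Gegenbauer polynomial of degree $s$ with parameter $\lambda$: $C_0^{(\lambda)}(z)=1$, $C_1^{(\lambda)}(z)=2\lambda z$, $nC_n^{(\lambda)}(z)=2(n+\lambda-1)zC_{n-1}^{(\lambda)}(z)-(n+2\lambda-2)C_{n-2}^{(\lambda)}(z)$; throughout $\lambda=\frac32$. Polynomials are evaluated at operators in the usual way, and $I$ is the identity. One step of the $s$-stage RKG1 method is $$u^{t+dt}=\frac{2}{(s+1)(s+2)}\,C_s^{(3/2)}\Big(I+\frac{4\,dt}{s^2+3s}\,\alpha M\Big)u^t.$$ A one-step method $u_i^{t+dt}=\mathcal{H}(u^t;i)$ (where $\mathcal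 H(\cdot\,;i)$ depends on finitely many entries of $u^t\in\mathbb{R}^{\mathbb Z}$) is called monotone if $\frac{\partial \mathcal{H}}{\partial u_j^t}(u^t;i)\ge 0$ for all grid indices $i,j\in\mathbb{Z}$ (and all $u^t$). *)

theory Defs
  imports Complex_Main "HOL-Computational_Algebra.Polynomial"
begin

text \<open>
  Grid functions, the elements of $\mathbb{R}^{\mathbb{Z}}$, are functions of type
  \<open>int \<Rightarrow> real\<close>. Periodic boundary conditions are the problem on $\mathbb{Z}$ with repeated
  values, and homogeneous Neumann conditions are the periodic problem on the reflected and
  doubled domain. Under either condition the scheme is therefore the one on
  \<open>int \<Rightarrow> real\<close> given below.
\<close>

type_synonym grid_fun = "int \<Rightarrow> real"

text \<open>The three-term recurrence, shifted to start at \<open>n + 2\<close> and divided by \<open>n + 2\<close>.\<close>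

fun gegenbauer :: "real \<Rightarrow> nat \<Rightarrow> real poly" where
  "gegenbauer l 0 = 1"
| "gegenbauer l (Suc 0) = [:0, 2 * l:]"
| "gegenbauer l (Suc (Suc n)) =
     smult (1 / real (n + 2))
       (smult (2 * (real (n + 2) + l - 1)) ([:0, 1:] * gegenbauer l (Suc n))
        - smult (real (n + 2) + 2 * l - 2) (gegenbauer l n))"

definition poly_op :: "real poly \<Rightarrow> (grid_fun \<Rightarrow> grid_fun) \<Rightarrow> grid_fun \<Rightarrow> grid_fun" where
  "poly_op p A u = (\<lambda>i. \<Sum>k\<le>degree p. coeff p k * (A ^^ k) u i)"

definition central_diff :: "real \<Rightarrow> grid_fun \<Rightarrow> grid_fun" where
  "central_diff dx u = (\<lambda>i. (u (i + 1) - 2 * u i + u (i - 1)) / dx\<^sup>2)"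

definition rkg1_arg :: "real \<Rightarrow> real \<Rightarrow> real \<Rightarrow> nat \<Rightarrow> grid_fun \<Rightarrow> grid_fun" where
  "rkg1_arg \<alpha> dt dx s u =
     (\<lambda>i. u i + 4 * dt / ((real s)\<^sup>2 + 3 * real s) * (\<alpha> * central_diff dx u i))"

definition rkg1_step :: "real \<Rightarrow> real \<Rightarrow> real \<Rightarrow> nat \<Rightarrow> grid_fun \<Rightarrow> grid_fun" where
  "rkg1_step \<alpha> dt dx s u =
     (\<lambda>i. 2 / ((real s + 1) * (real s + 2))
          * poly_op (gegenbauer (3 / 2) s) (rkg1_arg \<alpha> dt dx s) u i)"

text \<open>\<open>H u i\<close> is the value at \<open>i\<close> after one step from \<open>u\<close>.\<close>

definition one_step_method :: "(grid_fun \<Rightarrow> grid_fun) \<Rightarrow> bool" where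
  "one_step_method H \<longleftrightarrow>
     (\<forall>i. \<exists>S. finite S \<and> (\<forall>u v. (\<forall>j\<in>S. u j = v j) \<longrightarrow> H u i = H v i))"

text \<open>
  The partial derivative of \<open>H(\<cdot>; i)\<close> with respect to the \<open>j\<close>-th entry is required to exist
  at every \<open>u\<close>, not just to be nonnegative where it exists.
\<close>

definition monotone_method :: "(grid_fun \<Rightarrow> grid_fun) \<Rightarrow> bool" where
  "monotone_method H \<longleftrightarrow>
     one_step_method H \<and>
     (\<forall>u i j. \<exists>D. ((\<lambda>x. H (u(j := x)) i) has_real_derivative D) (at (u j)) \<and> D \<ge> 0)"

end

theory Submission
  imports Defs
begin

text \<open>
  Under the stability constraint the argument of the Gegenbauer polynomial is
  $y^2 + (1 - y^2) X$, where $X$ is half the sum of the two unit shifts and $0 \le y^2 \le 1$.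
  The addition theorem for Gegenbauer polynomials, at equal angles with cosine $y$, expands
  $C_n^{(3/2)}(y^2 + (1 - y^2) X)$ in the Chebyshev polynomials $U_m(X)$, and at equal angles its
  coefficients contain squares and so are nonnegative. Since $U_m(X)$ is a plain sum of shifts,
  the step has nonnegative weights. The addition theorem is verified by checking that its
  coefficients satisfy the three-term recurrence in $n$.
\<close>

section \<open>Derivative relations for Gegenbauer polynomials with parameter 3/2\<close>

lemma higher_pderiv_diff:
  fixes p q :: "'a :: idom poly"
  shows "(pderiv ^^ m) (p - q) = (pderiv ^^ m) p - (pderiv ^^ m) q"
  by (induction m) (simp_all add: pderiv_diff)

lemma higher_pderiv_X_mult_pderiv:
  fixes p :: "'a :: idom poly"
  shows "(pderiv ^^ m) ([:0, 1:] * pderiv p) =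
    [:0, 1:] * (pderiv ^^ Suc m) p + smult (of_nat m) ((pderiv ^^ m) p)"
proof (induction m)
  case (Suc m)
  have "(pderiv ^^ Suc m) ([:0, 1:] * pderiv p) =
      pderiv ([:0, 1:] * (pderiv ^^ Suc m) p + smult (of_nat m) ((pderiv ^^ m) p))"
    using Suc by simp
  also have "\<dots> = [:0, 1:] * (pderiv ^^ Suc (Suc m)) p + smult (of_nat (Suc m)) ((pderiv ^^ Suc m) p)"
    by (simp add: pderiv_mult pderiv_add pderiv_smult pderiv_pCons smult_add_left)
  finally show ?case .
qed simp

lemma degree_gegenbauer_le: "degree (gegenbauer l n) \<le> n"
proof (induction l n rule: gegenbauer.induct)
  case (3 l n)
  have "degree ([:0, 1:] * gegenbauer l (Suc n)) \<le> Suc (Suc n)"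
    using 3 by (auto simp: degree_pCons_eq_if)
  moreover have "degree (gegenbauer l n) \<le> Suc (Suc n)"
    using 3 by simp
  ultimately show ?case
    by (auto intro!: degree_diff_le order.trans[OF degree_smult_le] simp del: mult_pCons_left)
qed auto

lemma gegenbauer_3_2_recurrence:
  "smult (real (n + 2)) (gegenbauer (3 / 2) (n + 2)) =
     smult (real (2 * n + 5)) ([:0, 1:] * gegenbauer (3 / 2) (n + 1))
     - smult (real (n + 3)) (gegenbauer (3 / 2) n)"
proof -
  have "2 * (real (n + 2) + 3 / 2 - 1) = real (2 * n + 5)" "real (n + 2) + 2 * (3 / 2) - 2 = real (n + 3)"
    by simp_all
  then show ?thesis
    unfolding add_2_eq_Suc' Suc_eq_plus1[symmetric] gegenbauer.simps by (simp add: add.commute)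
qed

text \<open>The classical contiguity relations, analogues of those for Legendre polynomials. They
  are proved jointly: \<open>?B (n + 1)\<close> follows from \<open>?A n\<close> and the
  differentiated recurrence, and \<open>?A (n + 1)\<close> then from all of these with the
  recurrence itself.\<close>

lemma pderiv_gegenbauer_3_2:
  "[:0, 1:] * pderiv (gegenbauer (3 / 2) (n + 1)) - pderiv (gegenbauer (3 / 2) n) =
     smult (real (n + 1)) (gegenbauer (3 / 2) (n + 1))" (is "?A n")
  "pderiv (gegenbauer (3 / 2) (n + 1)) - [:0, 1:] * pderiv (gegenbauer (3 / 2) n) =
     smult (real (n + 3)) (gegenbauer (3 / 2) n)" (is "?B n")
proof -
  have "?A n \<and> ?B n"
  proof (induction n)
    case 0
    then show ?case by (simp add: pderiv_pCons)
  next
    case (Suc n)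
    define C where "C = gegenbauer (3 / 2)"
    define P where "P = (\<lambda>k x. poly (C k) x)"
    define D where "D = (\<lambda>k x. poly (pderiv (C k)) x)"
    have A: "x * D (n + 1) x - D n x = real (n + 1) * P (n + 1) x" for x
      using arg_cong[OF conjunct1[OF Suc], of "\<lambda>p. poly p x"]
      unfolding C_def[symmetric] by (simp add: P_def D_def)
    have B: "D (n + 1) x - x * D n x = real (n + 3) * P n x" for x
      using arg_cong[OF conjunct2[OF Suc], of "\<lambda>p. poly p x"]
      unfolding C_def[symmetric] by (simp add: P_def D_def)
    have R: "real (n + 2) * P (n + 2) x = real (2 * n + 5) * (x * P (n + 1) x) - real (n + 3) * P n x"
      for x
      using arg_cong[OF gegenbauer_3_2_recurrence[of n], of "\<lambda>p. poly p x"]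
      unfolding C_def[symmetric] by (simp add: P_def)
    have R': "real (n + 2) * D (n + 2) x =
        real (2 * n + 5) * (P (n + 1) x + x * D (n + 1) x) - real (n + 3) * D n x" for x
      using arg_cong[OF gegenbauer_3_2_recurrence[of n], of "\<lambda>p. poly (pderiv p) x"]
      unfolding C_def[symmetric]
      by (simp add: P_def D_def pderiv_smult pderiv_diff pderiv_mult pderiv_pCons
          del: mult_pCons_left)
    have B': "D (n + 2) x - x * D (n + 1) x = real (n + 4) * P (n + 1) x" for x
    proof -
      \<comment> \<open>Eliminating \<open>D n x\<close> by \<open>A\<close> leaves a common factor
        n + 2, because (2n + 5) + (n + 1)(n + 3) = (n + 2)(n + 4).\<close>
      have "real (n + 2) * (D (n + 2) x - x * D (n + 1) x) = real (n + 2) * (real (n + 4) * P (n + 1) x)"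
        using A[of x] R'[of x] unfolding of_nat_add of_nat_mult of_nat_numeral of_nat_1 by algebra
      then show ?thesis by (simp del: of_nat_add of_nat_Suc)
    qed
    have A': "x * D (n + 2) x - D (n + 1) x = real (n + 2) * P (n + 2) x" for x
      using A[of x] B[of x] B'[of x] R[of x]
      unfolding of_nat_add of_nat_mult of_nat_numeral of_nat_1 by algebra
    show ?case
      unfolding C_def[symmetric] poly_eq_poly_eq_iff[symmetric] fun_eq_iff
      using A' B' by (simp add: P_def D_def)
  qed
  then show "?A n" "?B n" by blast+
qed

definition gegenbauer_deriv :: "real \<Rightarrow> nat \<Rightarrow> nat \<Rightarrow> real" where
  "gegenbauer_deriv y n m = poly ((pderiv ^^ m) (gegenbauer (3 / 2) n)) y"

lemma gegenbauer_deriv_eq_0: "n < m \<Longrightarrow> gegenbauer_deriv y n m = 0"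
proof -
  assume "n < m"
  have "coeff ((pderiv ^^ m) (gegenbauer (3 / 2) n)) k = 0" for k
    using degree_gegenbauer_le[of "3 / 2" n] \<open>n < m\<close>
    by (simp add: coeff_higher_pderiv coeff_eq_0)
  then show ?thesis
    by (metis gegenbauer_deriv_def leading_coeff_0_iff poly_0)
qed

text \<open>Differentiate the first contiguity relation m times. The factor X adds m times a lower
  derivative, which turns n + 1 into n + 1 - m; in the second relation it turns n + 3 into n + 3 +
  m.\<close>

lemma gegenbauer_deriv_down:
  "y * gegenbauer_deriv y (n + 1) (m + 1) - gegenbauer_deriv y n (m + 1) =
     (real n + 1 - real m) * gegenbauer_deriv y (n + 1) m"
  using arg_cong[OF pderiv_gegenbauer_3_2(1)[of n], of "\<lambda>p. poly ((pderiv ^^ m) p) y"]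
  unfolding higher_pderiv_diff higher_pderiv_smult higher_pderiv_X_mult_pderiv
    Suc_eq_plus1 gegenbauer_deriv_def
  by (simp add: algebra_simps funpow_swap1 del: gegenbauer.simps)

lemma gegenbauer_deriv_up:
  "gegenbauer_deriv y (n + 1) (m + 1) - y * gegenbauer_deriv y n (m + 1) =
     (real n + 3 + real m) * gegenbauer_deriv y n m"
  using arg_cong[OF pderiv_gegenbauer_3_2(2)[of n], of "\<lambda>p. poly ((pderiv ^^ m) p) y"]
  unfolding higher_pderiv_diff higher_pderiv_smult higher_pderiv_X_mult_pderiv
    Suc_eq_plus1 gegenbauer_deriv_def
  by (simp add: algebra_simps funpow_swap1 del: gegenbauer.simps)

text \<open>The three-term recurrence for parameter m + 3/2 in degree n + 2 - m. For m > 0 it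
  results from eliminating the derivative of order m - 1 between the two relations above.\<close>

lemma gegenbauer_deriv_recurrence:
  "(real n + 2 - real m) * gegenbauer_deriv y (n + 2) m =
     (2 * real n + 5) * y * gegenbauer_deriv y (n + 1) m
     - (real n + real m + 3) * gegenbauer_deriv y n m"
proof (cases m)
  case 0
  then show ?thesis
    using arg_cong[OF gegenbauer_3_2_recurrence[of n], of "\<lambda>p. poly p y"]
    by (simp add: gegenbauer_deriv_def algebra_simps del: gegenbauer.simps)
next
  case (Suc k)
  show ?thesis
    using gegenbauer_deriv_down[of y n k] gegenbauer_deriv_up[of y "n + 1" k]
    unfolding Suc Suc_eq_plus1 add.assoc one_add_one of_nat_add of_nat_1
    by algebra
qed

text \<open>Subtracting y times the first relation from the second cancels
  \<open>gegenbauer_deriv y n (m + 1)\<close>, so order m + 1 is expressed by order m alone.\<close>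

lemma gegenbauer_deriv_Suc_order:
  "(1 - y\<^sup>2) * gegenbauer_deriv y (n + 1) (m + 1) =
     (real n + real m + 3) * gegenbauer_deriv y n m
     - (real n + 1 - real m) * y * gegenbauer_deriv y (n + 1) m"
  using gegenbauer_deriv_down[of y n m] gegenbauer_deriv_up[of y n m] by algebra

section \<open>Coefficients of the addition theorem and their recurrence\<close>

text \<open>
  The factor $C_{n-m}^{(m+3/2)}(y)$ of the usual addition theorem is, up to a constant depending
  only on $m$, the $m$-th derivative of $C_n^{(3/2)}$ at $y$.
\<close>

definition addition_coeff :: "real \<Rightarrow> nat \<Rightarrow> nat \<Rightarrow> real" where
  "addition_coeff y n m =
     2 * (real m + 1) * (fact (n - m) / fact (n + m + 2))
     * ((1 - y\<^sup>2) ^ m * (gegenbauer_deriv y n m)\<^sup>2)"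

lemma addition_coeff_nonneg: "y\<^sup>2 \<le> 1 \<Longrightarrow> 0 \<le> addition_coeff y n m"
  by (simp add: addition_coeff_def)

lemma addition_coeff_eq_0: "n < m \<Longrightarrow> addition_coeff y n m = 0"
  by (simp add: addition_coeff_def gegenbauer_deriv_eq_0)

text \<open>This compares coefficients of U_m(X) in the three-term recurrence at y^2 + (1 - y^2) X.
  Since 2 X U_k = U_(k+1) + U_(k-1), order m receives contributions from its two neighbours.\<close>

lemma addition_coeff_recurrence:
  "(real n + 2) * addition_coeff y (n + 2) m =
     (2 * real n + 5) * (y\<^sup>2 * addition_coeff y (n + 1) m + (1 - y\<^sup>2) / 2 *
       (addition_coeff y (n + 1) (m + 1) + (if m = 0 then 0 else addition_coeff y (n + 1) (m - 1))))
     - (real n + 3) * addition_coeff y n m"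
proof -
  define G where "G = gegenbauer_deriv y"
  define b where "b = 1 - y\<^sup>2"
  have rec: "(real n + 2 - real m) * G (n + 2) m =
      (2 * real n + 5) * y * G (n + 1) m - (real n + real m + 3) * G n m"
    unfolding G_def by (rule gegenbauer_deriv_recurrence)
  have up: "b * G (n + 1) (m + 1) = (real n + real m + 3) * G n m
      - (real n + 1 - real m) * y * G (n + 1) m"
    unfolding G_def b_def by (rule gegenbauer_deriv_Suc_order)
  have down: "(real n + 2 - real m) * G (n + 1) (m - 1) = y * G (n + 1) m - G n m" if "m > 0"
    using gegenbauer_deriv_down[of y n "m - 1"] that unfolding G_def by (simp add: of_nat_diff)
  note z = gegenbauer_deriv_eq_0[of _ _ y, folded G_def]
  \<comment> \<open>For \<open>m > n\<close> the factorial of the truncated \<open>n - m\<close> is junk, hence the boundary cases.\<close>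
  consider "m \<le> n" | "m = n + 1" | "m = n + 2" | "m > n + 2" by linarith
  then show ?thesis
  proof cases
    case 1
    then obtain k where n: "n = m + k" by (auto simp: le_iff_add)
    define M where "M = real m"
    define K where "K = real k"
    have MK: "M \<ge> 0" "K \<ge> 0" by (simp_all add: M_def K_def)
    \<comment> \<open>By \<open>rec\<close>, \<open>up\<close> and \<open>down\<close>, the other
      three derivatives in the claim are combinations of \<open>p\<close> and
      \<open>q\<close>.\<close>
    define p where "p = G (n + 1) m"
    define q where "q = G n m"
    \<comment> \<open>The ratio in \<open>addition_coeff y (n + 1) (m + 1)\<close>. It has the
      smallest numerator and the largest denominator of the five, so the others are polynomial
      multiples of it.\<close>
    define w where "w = fact k / (fact (n + m + 4) :: real)"
    have fact3: "fact (n + m + 3) = (2 * M + K + 3) * (fact (n + m + 2) :: real)"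
      and fact4: "fact (n + m + 4) = (2 * M + K + 4) * (fact (n + m + 3) :: real)"
      and factk: "fact (k + 1) = (K + 1) * (fact k :: real)" "fact (k + 2) = (K + 2) * ((K + 1) * (fact k :: real))"
      by (simp_all add: n M_def K_def eval_nat_numeral add.commute)
    have pos: "2 * M + K + 3 > 0" "2 * M + K + 4 > 0" "(fact (n + m + 2) :: real) > 0"
      using MK by simp_all
    have ratio22: "fact (k + 2) / fact (n + m + 4) = w * (K + 1) * (K + 2)"
      and ratio11: "fact (k + 1) / fact (n + m + 3) = w * (K + 1) * (2 * M + K + 4)"
      and ratio00: "fact k / fact (n + m + 2) = w * (2 * M + K + 3) * (2 * M + K + 4)"
      and ratio20: "fact (k + 2) / fact (n + m + 2) = w * (K + 1) * (K + 2) * (2 * M + K + 3) * (2 * M + K + 4)"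
      unfolding w_def fact4 fact3 factk using pos by (simp_all add: divide_simps)
    have g: "G (n + 2) m = ((2 * (M + K) + 5) * y * p - (2 * M + K + 3) * q) / (K + 2)"
      using rec MK by (simp add: n M_def K_def p_def q_def field_simps)
    have c2: "addition_coeff y (n + 2) m = 2 * (M + 1) * w * (K + 1) * (K + 2) * b ^ m * (G (n + 2) m)\<^sup>2"
    proof -
      have "n + 2 - m = k + 2" "n + 2 + m + 2 = n + m + 4" by (simp_all add: n)
      then show ?thesis
        unfolding addition_coeff_def ratio22 by (simp only: ratio22 G_def b_def M_def mult.assoc)
    qed
    have c1: "addition_coeff y (n + 1) m = 2 * (M + 1) * w * (K + 1) * (2 * M + K + 4) * b ^ m * p\<^sup>2"
      using ratio11 by (simp add: addition_coeff_def G_def b_def n M_def p_def algebra_simps eval_nat_numeral)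
    have c0: "addition_coeff y n m =
        2 * (M + 1) * w * (2 * M + K + 3) * (2 * M + K + 4) * b ^ m * q\<^sup>2"
      using ratio00 by (simp add: addition_coeff_def G_def b_def n M_def q_def algebra_simps)
    \<comment> \<open>The extra \<open>b\<close> turns \<open>b ^ (m + 1)\<close> into
      \<open>b ^ m\<close> times a square, which moves into the squared derivative to make
      \<open>up\<close> applicable.\<close>
    have "b * addition_coeff y (n + 1) (m + 1) = 2 * (M + 2) * w * b ^ m * (b * G (n + 1) (m + 1))\<^sup>2"
      by (simp add: addition_coeff_def G_def b_def n w_def M_def power2_eq_square eval_nat_numeral)
    then have cu: "b * addition_coeff y (n + 1) (m + 1) =
        2 * (M + 2) * w * b ^ m * ((2 * M + K + 3) * q - (K + 1) * y * p)\<^sup>2"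
      unfolding up by (simp add: n M_def K_def p_def q_def algebra_simps)
    \<comment> \<open>\<open>down\<close> gives K + 2 times the derivative, so squaring divides by
      (K + 2)^2, and one factor cancels against the factorial ratio. For m = 0 the factor
      \<open>M\<close> makes the right side vanish.\<close>
    have cd: "b * (if m = 0 then 0 else addition_coeff y (n + 1) (m - 1)) =
        2 * M * w * (K + 1) * (2 * M + K + 3) * (2 * M + K + 4) * b ^ m * (y * p - q)\<^sup>2 / (K + 2)"
    proof (cases m)
      case (Suc m')
      have "(y * p - q)\<^sup>2 = (K + 2)\<^sup>2 * (G (n + 1) m')\<^sup>2"
        using down Suc by (simp add: n M_def K_def p_def q_def add.commute flip: power_mult_distrib)
      then have "2 * M * w * (K + 1) * (2 * M + K + 3) * (2 * M + K + 4) * b ^ m * (y * p - q)\<^sup>2 / (K + 2) =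
          2 * M * (w * (K + 1) * (K + 2) * (2 * M + K + 3) * (2 * M + K + 4)) * b ^ m * (G (n + 1) m')\<^sup>2"
        using MK by (simp add: power2_eq_square)
      also have "\<dots> = b * addition_coeff y (n + 1) m'"
        unfolding ratio20[symmetric]
        by (simp add: addition_coeff_def G_def b_def n M_def Suc algebra_simps eval_nat_numeral)
      finally show ?thesis using Suc by simp
    qed (simp add: M_def)
    have nMK: "real n = M + K" by (simp add: n M_def K_def)
    \<comment> \<open>The claim multiplied by K + 2 and stripped of the common factor
      \<open>2 * w * b ^ m\<close>: a polynomial identity in \<open>M\<close>, \<open>K\<close>,
      \<open>y\<close>, \<open>p\<close>, \<open>q\<close>.\<close>
    have ring: "(M + K + 2) * ((M + 1) * (K + 1) * ((2 * (M + K) + 5) * y * p - (2 * M + K + 3) * q)\<^sup>2) =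
      (2 * (M + K) + 5) * (y\<^sup>2 * ((M + 1) * (K + 1) * (2 * M + K + 4) * p\<^sup>2) * (K + 2)
        + ((M + 2) * ((2 * M + K + 3) * q - (K + 1) * y * p)\<^sup>2 * (K + 2)
           + M * (K + 1) * (2 * M + K + 3) * (2 * M + K + 4) * (y * p - q)\<^sup>2) / 2)
      - (M + K + 3) * ((M + 1) * (2 * M + K + 3) * (2 * M + K + 4) * q\<^sup>2) * (K + 2)"
      by (simp add: field_simps power2_eq_square)
    have cancel: "(K + 2) * (c * (K + 2) * e * (L / (K + 2))\<^sup>2) = c * e * L\<^sup>2"
        "(K + 2) * (c / (K + 2)) = c" for c e L :: real
      using MK by (simp_all add: power2_eq_square)
    have "(K + 2) * ((real n + 2) * addition_coeff y (n + 2) m) = 2 * w * b ^ m *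
      ((M + K + 2) * ((M + 1) * (K + 1) * ((2 * (M + K) + 5) * y * p - (2 * M + K + 3) * q)\<^sup>2))"
      unfolding c2 g mult.left_commute[of "K + 2" "real n + 2"] cancel
      by (simp only: mult_ac nMK)
    also have "\<dots> = (2 * real n + 5) * (y\<^sup>2 * addition_coeff y (n + 1) m * (K + 2) +
       (b * addition_coeff y (n + 1) (m + 1) * (K + 2)
        + (K + 2) * (b * (if m = 0 then 0 else addition_coeff y (n + 1) (m - 1)))) / 2)
     - (real n + 3) * addition_coeff y n m * (K + 2)"
      unfolding ring c1 c0 cu cd cancel nMK
      by algebra
    also have "\<dots> = (K + 2) * ((2 * real n + 5) * (y\<^sup>2 * addition_coeff y (n + 1) m + b / 2 *
       (addition_coeff y (n + 1) (m + 1)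
        + (if m = 0 then 0 else addition_coeff y (n + 1) (m - 1))))
     - (real n + 3) * addition_coeff y n m)"
      by (simp add: algebra_simps add_divide_distrib)
    finally show ?thesis
      using MK unfolding b_def by (subst (asm) mult_cancel_left) auto
  next
    case 2
    \<comment> \<open>Here \<open>G n (n + 1)\<close> vanishes, so both values are multiples of the
      top derivative \<open>G (n + 1) (n + 1)\<close>.\<close>
    have g: "G (n + 2) (n + 1) = (2 * real n + 5) * y * G (n + 1) (n + 1)"
      using rec 2 z[of n "n + 1"] by simp
    have d: "G (n + 1) n = y * G (n + 1) (n + 1)"
      using down 2 z[of n "n + 1"] by simp
    define p where "p = G (n + 1) (n + 1)"
    define w where "w = 1 / (fact (2 * n + 5) :: real)"
    have w: "1 / fact (2 * n + 3) = (2 * real n + 4) * (2 * real n + 5) * w"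
        "1 / fact (2 * n + 4) = (2 * real n + 5) * w"
      by (simp_all add: w_def eval_nat_numeral divide_simps) (simp_all add: algebra_simps)
    have idx: "n + 2 - (n + 1) = 1" "n + 1 - n = 1" "n + 2 + (n + 1) + 2 = 2 * n + 5"
        "n + 1 + (n + 1) + 2 = 2 * n + 4" "n + 1 + n + 2 = 2 * n + 3"
      by simp_all
    have "addition_coeff y (n + 2) m =
        2 * (real n + 2) * w * (b ^ (n + 1) * ((2 * real n + 5) * y * p)\<^sup>2)"
      unfolding addition_coeff_def 2 idx w_def p_def g[symmetric] by (simp add: G_def b_def)
    moreover have "addition_coeff y (n + 1) m =
        2 * (real n + 2) * ((2 * real n + 5) * w) * (b ^ (n + 1) * p\<^sup>2)"
      unfolding addition_coeff_def 2 idx w(2)[symmetric] p_def by (simp add: G_def b_def)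
    moreover have "addition_coeff y (n + 1) (m - 1) =
        2 * (real n + 1) * ((2 * real n + 4) * (2 * real n + 5) * w) * (b ^ n * (y * p)\<^sup>2)"
      unfolding addition_coeff_def 2 add_diff_cancel_right' idx w(1)[symmetric] p_def d[symmetric]
      by (simp add: G_def b_def)
    moreover have "addition_coeff y (n + 1) (m + 1) = 0" "addition_coeff y n m = 0" "m \<noteq> 0"
      using 2 by (simp_all add: addition_coeff_eq_0)
    ultimately show ?thesis
      by (simp flip: b_def) (simp add: field_simps power2_eq_square)
  next
    case 3
    define p where "p = G (n + 1) (n + 1)"
    define w where "w = 1 / (fact (2 * n + 6) :: real)"
    \<comment> \<open>At m = n + 2 the left factor in \<open>rec\<close> is zero, so the top
      derivative has to come from \<open>gegenbauer_deriv_up\<close>.\<close>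
    have g: "G (n + 2) (n + 2) = (2 * real n + 5) * p"
      using gegenbauer_deriv_up[of y "n + 1" "n + 1"] z[of "n + 1" "n + 2"] by (simp add: G_def p_def)
    have w: "1 / fact (2 * n + 4) = (2 * real n + 5) * (2 * real n + 6) * w"
      by (simp add: w_def eval_nat_numeral divide_simps) (simp add: algebra_simps)
    have idx: "n + 2 - 1 = n + 1" "n + 2 + (n + 2) + 2 = 2 * n + 6" "n + 1 + (n + 1) + 2 = 2 * n + 4"
      by simp_all
    have "addition_coeff y (n + 2) m =
        2 * (real n + 3) * w * (b ^ (n + 2) * ((2 * real n + 5) * p)\<^sup>2)"
      unfolding addition_coeff_def 3 idx w_def g[symmetric] by (simp add: G_def b_def)
    moreover have "addition_coeff y (n + 1) (m - 1) =
        2 * (real n + 2) * ((2 * real n + 5) * (2 * real n + 6) * w) * (b ^ (n + 1) * p\<^sup>2)"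
      unfolding addition_coeff_def 3 idx w[symmetric] p_def by (simp add: G_def b_def)
    moreover have "addition_coeff y (n + 1) m = 0" "addition_coeff y (n + 1) (m + 1) = 0"
        "addition_coeff y n m = 0" "m \<noteq> 0"
      using 3 by (simp_all add: addition_coeff_eq_0)
    ultimately show ?thesis
      by (simp flip: b_def) (simp add: field_simps power2_eq_square)
  next
    case 4
    then show ?thesis by (simp add: addition_coeff_eq_0)
  qed
qed

section \<open>Sums of shifts and the averaging operator\<close>

text \<open>The Chebyshev polynomial $U_m$ of the second kind at half the sum of the two unit shifts.\<close>

definition shift_sum :: "nat \<Rightarrow> grid_fun \<Rightarrow> grid_fun" where
  "shift_sum m u i = (\<Sum>j\<le>m. u (i + int m - 2 * int j))"

text \<open>The relation 2 X U_m = U_(m+1) + U_(m-1) with U_(-1) = 0. The right translate lacks the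
  leftmost entry of U_(m+1), and the left translate has exactly that entry beyond U_(m-1).\<close>

lemma shift_sum_neighbours:
  "shift_sum m u (i + 1) + shift_sum m u (i - 1) =
     shift_sum (m + 1) u i + (if m = 0 then 0 else shift_sum (m - 1) u i)"
proof -
  have "shift_sum m u (i + 1) = shift_sum (m + 1) u i - u (i - int m - 1)"
    by (simp add: shift_sum_def algebra_simps)
  moreover have "shift_sum m u (i - 1) =
      (if m = 0 then 0 else shift_sum (m - 1) u i) + u (i - int m - 1)"
    by (cases m) (simp_all add: shift_sum_def algebra_simps)
  ultimately show ?thesis by simp
qed

text \<open>For b = 1 - y^2 this is the operator y^2 + (1 - y^2) X.\<close>

definition average_op :: "real \<Rightarrow> grid_fun \<Rightarrow> grid_fun" where
  "average_op b u i = (1 - b) * u i + b / 2 * (u (i + 1) + u (i - 1))"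

lemma shift_sum_average_op:
  "shift_sum m (average_op b u) i = (1 - b) * shift_sum m u i
     + b / 2 * (shift_sum (m + 1) u i + (if m = 0 then 0 else shift_sum (m - 1) u i))"
  unfolding shift_sum_neighbours[symmetric]
  by (simp add: shift_sum_def average_op_def sum.distrib sum_distrib_left diff_add_eq add_diff_eq
      flip: sum.distrib) (simp add: algebra_simps)

section \<open>Algebra of polynomials evaluated at operators\<close>

lemma poly_op_altdef:
  "degree p \<le> N \<Longrightarrow> poly_op p A u i = (\<Sum>k\<le>N. coeff p k * (A ^^ k) u i)"
  unfolding poly_op_def by (rule sum.mono_neutral_left) (auto simp: coeff_eq_0)

lemma poly_op_diff: "poly_op (p - q) A u i = poly_op p A u i - poly_op q A u i"
  using poly_op_altdef[of p "max (degree p) (degree q)" A u i]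
    poly_op_altdef[of q "max (degree p) (degree q)" A u i]
    poly_op_altdef[of "p - q" "max (degree p) (degree q)" A u i] degree_diff_le_max[of p q]
  by (simp add: algebra_simps sum_subtractf)

lemma poly_op_smult: "poly_op (smult c p) A u i = c * poly_op p A u i"
  using poly_op_altdef[of "smult c p" "degree p" A u i] poly_op_altdef[of p "degree p" A u i]
  by (simp add: sum_distrib_left algebra_simps degree_smult_le)

text \<open>The extra factor acts on \<open>u\<close> first, since pulling \<open>A\<close> out of
  the sum would require linearity. Hence the induction for the addition theorem keeps
  \<open>u\<close> arbitrary.\<close>

lemma poly_op_X_mult: "poly_op ([:0, 1:] * p) A u i = poly_op p A (A u) i"
proof -
  have "poly_op ([:0, 1:] * p) A u i = (\<Sum>k\<le>Suc (degree p). coeff (pCons 0 p) k * (A ^^ k) u i)"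
    using poly_op_altdef[of "pCons 0 p"] by (simp add: degree_pCons_le del: sum.atMost_Suc)
  then show ?thesis
    unfolding poly_op_def sum.atMost_Suc_shift by (simp add: funpow_swap1)
qed

section \<open>The addition theorem in operator form\<close>

lemma sum_addition_coeff_extend:
  "n \<le> N \<Longrightarrow> (\<Sum>m\<le>n. addition_coeff y n m * f m) = (\<Sum>m\<le>N. addition_coeff y n m * f m)"
  by (rule sum.mono_neutral_left) (auto simp: addition_coeff_eq_0)

text \<open>Both sides agree for n = 0 and n = 1 and obey the same three-term recurrence, the right
  side by \<open>addition_coeff_recurrence\<close>.\<close>

lemma poly_op_gegenbauer_average_op:
  "poly_op (gegenbauer (3 / 2) n) (average_op (1 - y\<^sup>2)) u i =
     (\<Sum>m\<le>n. addition_coeff y n m * shift_sum m u i)"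
proof (induction n arbitrary: u rule: induct_nat_012)
  case 0
  then show ?case
    by (simp add: poly_op_def addition_coeff_def gegenbauer_deriv_def shift_sum_def)
next
  case 1
  then show ?case
    by (simp add: poly_op_def addition_coeff_def gegenbauer_deriv_def shift_sum_def average_op_def
        eval_nat_numeral pderiv_pCons field_simps)
next
  case (ge2 n)
  define A where "A = average_op (1 - y\<^sup>2)"
  define d where "d = addition_coeff y"
  define V where "V = (\<lambda>m. shift_sum m u i)"
  have le: "n + 1 \<le> n + 2" by simp
  have up: "(\<Sum>m\<le>n + 1. d (n + 1) m * V (m + 1)) =
      (\<Sum>m\<le>n + 2. (if m = 0 then 0 else d (n + 1) (m - 1)) * V m)"
    by (simp add: sum.atMost_Suc_shift[of _ "Suc n"] del: sum.atMost_Suc)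
  \<comment> \<open>For m = n + 1 and m = n + 2 the order m + 1 exceeds the degree n + 1, so these
    coefficients vanish.\<close>
  have "(\<Sum>m\<le>n + 2. d (n + 1) (m + 1) * V m) = (\<Sum>m\<le>n. d (n + 1) (m + 1) * V m)"
    by (rule sum.mono_neutral_right) (auto simp: d_def addition_coeff_eq_0)
  then have down: "(\<Sum>m\<le>n + 1. d (n + 1) m * (if m = 0 then 0 else V (m - 1))) =
      (\<Sum>m\<le>n + 2. d (n + 1) (m + 1) * V m)"
    by (simp add: sum.atMost_Suc_shift del: sum.atMost_Suc)
  have IH0: "poly_op (gegenbauer (3 / 2) n) A u i = (\<Sum>m\<le>n + 2. d n m * V m)"
    unfolding A_def d_def V_def ge2(1) by (rule sum_addition_coeff_extend) simp
  have "poly_op (gegenbauer (3 / 2) (n + 1)) A (A u) i =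
      (\<Sum>m\<le>n + 1. d (n + 1) m * shift_sum m (A u) i)"
    using ge2(2) by (simp add: A_def d_def)
  also have "\<dots> = y\<^sup>2 * (\<Sum>m\<le>n + 1. d (n + 1) m * V m) + (1 - y\<^sup>2) / 2 *
      ((\<Sum>m\<le>n + 1. d (n + 1) m * V (m + 1))
        + (\<Sum>m\<le>n + 1. d (n + 1) m * (if m = 0 then 0 else V (m - 1))))"
    unfolding A_def shift_sum_average_op V_def sum_distrib_left sum.distrib[symmetric]
    by (rule sum.cong) (simp_all add: algebra_simps)
  also have "\<dots> = (\<Sum>m\<le>n + 2. (y\<^sup>2 * d (n + 1) m + (1 - y\<^sup>2) / 2 *
      (d (n + 1) (m + 1) + (if m = 0 then 0 else d (n + 1) (m - 1)))) * V m)"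
    unfolding up down sum_addition_coeff_extend[of "n + 1" "n + 2" y V, folded d_def, OF le]
      sum_distrib_left sum.distrib[symmetric]
    by (rule sum.cong) (simp_all add: algebra_simps)
  finally have IH1: "poly_op (gegenbauer (3 / 2) (n + 1)) A (A u) i = \<dots>" .
  have "real (n + 2) * poly_op (gegenbauer (3 / 2) (n + 2)) A u i =
      real (2 * n + 5) * poly_op (gegenbauer (3 / 2) (n + 1)) A (A u) i
      - real (n + 3) * poly_op (gegenbauer (3 / 2) n) A u i"
    using arg_cong[OF gegenbauer_3_2_recurrence[of n], of "\<lambda>p. poly_op p A u i"]
    unfolding poly_op_diff poly_op_smult poly_op_X_mult .
  also have "\<dots> = (\<Sum>m\<le>n + 2. (real n + 2) * d (n + 2) m * V m)"
    unfolding IH0 IH1 d_def addition_coeff_recurrence sum_distrib_left sum_subtractf[symmetric]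
    by (rule sum.cong) (simp_all add: algebra_simps)
  also have "\<dots> = real (n + 2) * (\<Sum>m\<le>n + 2. d (n + 2) m * V m)"
    by (simp add: sum_distrib_left algebra_simps)
  finally show ?case
    by (simp add: A_def d_def V_def)
qed

section \<open>Monotonicity of the RKG1 step\<close>

lemma rkg1_arg_eq_average_op:
  "rkg1_arg \<alpha> dt dx s = average_op (8 / ((real s)\<^sup>2 + 3 * real s) * (\<alpha> * (dt / dx\<^sup>2)))"
proof (intro ext)
  fix u i
  define r where "r = 4 * dt / ((real s)\<^sup>2 + 3 * real s) * \<alpha> / dx\<^sup>2"
  have "rkg1_arg \<alpha> dt dx s u i = u i + r * (u (i + 1) - 2 * u i + u (i - 1))"
    by (simp add: rkg1_arg_def central_diff_def r_def)
  also have "\<dots> = average_op (2 * r) u i"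
    by (simp add: average_op_def algebra_simps)
  also have "2 * r = 8 / ((real s)\<^sup>2 + 3 * real s) * (\<alpha> * (dt / dx\<^sup>2))"
    by (simp add: r_def)
  finally show "rkg1_arg \<alpha> dt dx s u i =
      average_op (8 / ((real s)\<^sup>2 + 3 * real s) * (\<alpha> * (dt / dx\<^sup>2))) u i" .
qed

lemma monotone_method_shift_sums:
  assumes "\<And>m. m \<le> n \<Longrightarrow> 0 \<le> c m"
  shows "monotone_method (\<lambda>u i. \<Sum>m\<le>n. c m * shift_sum m u i)"
  unfolding monotone_method_def one_step_method_def
proof (intro conjI allI)
  fix i :: int
  let ?S = "(\<lambda>(m, j). i + int m - 2 * int j) ` ({..n} \<times> {..n})"
  show "\<exists>S. finite S \<and> (\<forall>u v. (\<forall>j\<in>S. u j = v j) \<longrightarrow>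
      (\<Sum>m\<le>n. c m * shift_sum m u i) = (\<Sum>m\<le>n. c m * shift_sum m v i))"
  proof (intro exI[of _ ?S] conjI allI impI)
    fix u v :: grid_fun
    assume "\<forall>j\<in>?S. u j = v j"
    then show "(\<Sum>m\<le>n. c m * shift_sum m u i) = (\<Sum>m\<le>n. c m * shift_sum m v i)"
      unfolding shift_sum_def by (intro sum.cong refl arg_cong2[of _ _ _ _ "(*)"]) force
  qed simp
next
  fix u :: grid_fun and i j :: int
  \<comment> \<open>Each entry has a Kronecker delta as its derivative, so the derivative of the
    step counts, with weights \<open>c m\<close>, the shifts from \<open>i\<close> that land on
    \<open>j\<close>.\<close>
  have "((\<lambda>x. (u(j := x)) k) has_real_derivative of_bool (k = j)) (at (u j))" for k
    by (cases "k = j") auto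
  then have "((\<lambda>x. \<Sum>m\<le>n. c m * shift_sum m (u(j := x)) i) has_real_derivative
      (\<Sum>m\<le>n. c m * (\<Sum>l\<le>m. of_bool (i + int m - 2 * int l = j)))) (at (u j))"
    unfolding shift_sum_def by (intro DERIV_sum DERIV_cmult)
  moreover have "0 \<le> (\<Sum>m\<le>n. c m * (\<Sum>l\<le>m. of_bool (i + int m - 2 * int l = j)))"
    using assms by (intro sum_nonneg mult_nonneg_nonneg) auto
  ultimately show "\<exists>D. ((\<lambda>x. \<Sum>m\<le>n. c m * shift_sum m (u(j := x)) i)
      has_real_derivative D) (at (u j)) \<and> D \<ge> 0" by blast
qed

theorem theorem5p9:
  fixes \<alpha> dt dx :: real and s :: nat
  assumes "\<alpha> > 0" and "dt > 0" and "dx > 0" and "s \<ge> 1"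
    and "\<alpha> * (dt / dx\<^sup>2) \<le> ((real s)\<^sup>2 + 3 * real s) / 8"
  shows "monotone_method (rkg1_step \<alpha> dt dx s)"
proof -
  define b where "b = 8 / ((real s)\<^sup>2 + 3 * real s) * (\<alpha> * (dt / dx\<^sup>2))"
  \<comment> \<open>The stability constraint amounts to b \<le> 1, which makes the root real with
    y^2 = 1 - b; b \<ge> 0 then gives y^2 \<le> 1, as nonnegative coefficients require.\<close>
  define y where "y = sqrt (1 - b)"
  have pos: "(real s)\<^sup>2 + 3 * real s > 0"
    using assms by (simp add: add_pos_pos)
  have "b \<le> 1"
    using assms(5) pos unfolding b_def times_divide_eq_left by (subst divide_le_eq_1_pos) (auto simp: mult_ac)
  moreover have "b \<ge> 0"
    using assms pos by (simp add: b_def)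
  ultimately have b: "b = 1 - y\<^sup>2" and y: "y\<^sup>2 \<le> 1"
    by (simp_all add: y_def)
  have "rkg1_step \<alpha> dt dx s = (\<lambda>u i. \<Sum>m\<le>s.
      2 / ((real s + 1) * (real s + 2)) * addition_coeff y s m * shift_sum m u i)"
    unfolding rkg1_step_def rkg1_arg_eq_average_op b_def[symmetric]
    unfolding b poly_op_gegenbauer_average_op by (simp add: sum_distrib_left mult.assoc)
  moreover have "monotone_method \<dots>"
    using y by (intro monotone_method_shift_sums mult_nonneg_nonneg addition_coeff_nonneg) auto
  ultimately show ?thesis by simp
qed

end
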